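(* Let $A\in\mathbb{R}^{n\times n}$ be a nonzero symmetric positive semi-definite matrix, let $m=\sqrt{\|A\|_1\|A\|_\infty}$ be the scaling factor, and let $\hat A=\frac{A}{m}$. Apply the two-sided Jacobi EVD algorithm (described in the context, in exact real arithmetic) to $\hat A$. Then, throughout the run of the algorithm, i.e. at every iteration (every sweep and every index pair $(i,j)$ in it), the variables of the algorithm satisfy the following bounds: \begin{itemize} \item every entry of the working matrix $\hat A$ (the input matrix and all its updates) lies in $[-1,1]$; \item $t\in[-1,1]$; \item $cs\in[0,1]$; \item $sn\in[-1,1]$; \item every entry of $X$ lies in $[-1,1]$; \item $a\in[0,1]$; \item $b\in[0,1]$; \item $c\in[-1,1]$; \item every output value $\hat\lambda_i$, $1\le i\le n$, lies in $[0,1]$. \end{itemize}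
   Context: $\|\cdot\|_1$, $\|\cdot\|_\infty$ are the operator norms (maximum absolute column sum, maximum absolute row sum). Two-sided Jacobi EVD algorithm, written for the input $\hat A$. Input: a symmetric $n\times n$ real matrix, stored in the working matrix $\hat A$, which is overwritten; $X$ is initialized as the $n\times n$ identity. For each sweep $l=1,\dots,n$, for each $i=1,\dots,n$, for each $j=i+1,\dots,n$, do the following steps in order. (1) Set $a=\hat A(i,i)$, $b=\hat A(j,j)$, $c=\hat A(i,j)=\hat A(j,i)$. (2) Set $t=\dfrac{\mathrm{sign}\left(\frac{b-a}{c}\right)|c|}{\left|\frac{b-a}{2}\right|+\sqrt{c^2+\left(\frac{b-a}{2}\right)^2}}$, $cs=1/\sqrt{1+t^2}$, $sn=cs\cdot t$. Conventions: $\mathrm{sign}(0)=1$, and $t=0$ if $c=0$. (3) Set $\hat A(i,i)=a-c\,t$, $\hat A(j,j)=b+c\,t$, $\hat A(i,j)=\hat A(j,i)=0$. (4) For each $k=1,\dots,n$ with $k\ne i,j$: set $tmp=\hat A(i,k)$; then $\hat A(i,k)=cs\cdot tmp-sn\cdot \hat A(j,k)$; then $\hat A(j,k)=sn\cdot tmp+cs\cdot \hat A(j,k)$; then $\hat A(k,i)=\hat A(i,k)$ and $\hat A(k,j)=\hat A(j,k)$. (5) For each $k=1,\dots,n$: set $tmp=X(k,i)$; then $X(k,i)=cs\cdot tmp-sn\cdot X(k,j)$; then $X(k,j)=sn\cdot tmp+cs\cdot X(k,j)$. After all sweeps, output $\hat\lambda_i=\hat A(i,i)$ for $i=1,\dots,n$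 (the computed eigenvalues) and $X$ (the computed eigenvectors). *)

theory Defs
  imports Complex_Main "Jordan_Normal_Form.Matrix"
begin

text \<open>Matrices are 0-indexed: the indices $1, \dots, n$ of the mathematical text are
  $0, \dots, n - 1$ here.\<close>

definition norm1_mat :: "real mat \<Rightarrow> real" where
  "norm1_mat A = Max ((\<lambda>j. \<Sum>i<dim_row A. \<bar>A $$ (i, j)\<bar>) ` {..<dim_col A})"

definition norminf_mat :: "real mat \<Rightarrow> real" where
  "norminf_mat A = Max ((\<lambda>i. \<Sum>j<dim_col A. \<bar>A $$ (i, j)\<bar>) ` {..<dim_row A})"

definition sym_psd_mat :: "nat \<Rightarrow> real mat \<Rightarrow> bool" where
  "sym_psd_mat n A \<longleftrightarrow> A \<in> carrier_mat n n \<and> transpose_mat A = A \<and>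
     (\<forall>v \<in> carrier_vec n. v \<bullet> (A *\<^sub>v v) \<ge> 0)"

definition mat_upd :: "'a mat \<Rightarrow> nat \<Rightarrow> nat \<Rightarrow> 'a \<Rightarrow> 'a mat" where
  "mat_upd M r s x = mat (dim_row M) (dim_col M) (\<lambda>p. if p = (r, s) then x else M $$ p)"

text \<open>Unlike the library's \<^const>\<open>sgn\<close>, the sign of 0 is 1.\<close>

definition sign1 :: "real \<Rightarrow> real" where
  "sign1 x = (if x < 0 then -1 else 1)"

definition jacobi_tan :: "real \<Rightarrow> real \<Rightarrow> real \<Rightarrow> real" where
  "jacobi_tan a b c = (if c = 0 then 0 else
     sign1 ((b - a) / c) * \<bar>c\<bar> / (\<bar>(b - a) / 2\<bar> + sqrt (c\<^sup>2 + ((b - a) / 2)\<^sup>2)))"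

text \<open>The algorithm is a straight-line program: a list of single assignments acting on the
  program variables. Every state between two assignments, and not just those between
  rotations, is therefore a point of the run.\<close>

record jacobi_state =
  Ahat :: "real mat"
  Xmat :: "real mat"
  var_a :: real
  var_b :: real
  var_c :: real
  var_t :: real
  var_cs :: real
  var_sn :: real
  var_tmp :: real

type_synonym assignment = "jacobi_state \<Rightarrow> jacobi_state"

definition set_A :: "nat \<Rightarrow> nat \<Rightarrow> (jacobi_state \<Rightarrow> real) \<Rightarrow> assignment" where
  "set_A r k e = (\<lambda>s. s\<lparr>Ahat := mat_upd (Ahat s) r k (e s)\<rparr>)"

definition set_X :: "nat \<Rightarrow> nat \<Rightarrow> (jacobi_state \<Rightarrow> real) \<Rightarrow> assignment" where
  "set_X r k e = (\<lambda>s. s\<lparr>Xmat := mat_upd (Xmat s) r k (e s)\<rparr>)"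

definition jacobi_step1 :: "nat \<Rightarrow> nat \<Rightarrow> assignment list" where
  "jacobi_step1 i j =
    [\<lambda>s. s\<lparr>var_a := Ahat s $$ (i, i)\<rparr>,
     \<lambda>s. s\<lparr>var_b := Ahat s $$ (j, j)\<rparr>,
     \<lambda>s. s\<lparr>var_c := Ahat s $$ (i, j)\<rparr>]"

definition jacobi_step2 :: "assignment list" where
  "jacobi_step2 =
    [\<lambda>s. s\<lparr>var_t := jacobi_tan (var_a s) (var_b s) (var_c s)\<rparr>,
     \<lambda>s. s\<lparr>var_cs := 1 / sqrt (1 + (var_t s)\<^sup>2)\<rparr>,
     \<lambda>s. s\<lparr>var_sn := var_cs s * var_t s\<rparr>]"

definition jacobi_step3 :: "nat \<Rightarrow> nat \<Rightarrow> assignment list" where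
  "jacobi_step3 i j =
    [set_A i i (\<lambda>s. var_a s - var_c s * var_t s),
     set_A j j (\<lambda>s. var_b s + var_c s * var_t s),
     set_A i j (\<lambda>s. 0),
     set_A j i (\<lambda>s. 0)]"

definition jacobi_step4 :: "nat \<Rightarrow> nat \<Rightarrow> nat \<Rightarrow> assignment list" where
  "jacobi_step4 n i j = concat (map (\<lambda>k.
    [\<lambda>s. s\<lparr>var_tmp := Ahat s $$ (i, k)\<rparr>,
     set_A i k (\<lambda>s. var_cs s * var_tmp s - var_sn s * Ahat s $$ (j, k)),
     set_A j k (\<lambda>s. var_sn s * var_tmp s + var_cs s * Ahat s $$ (j, k)),
     set_A k i (\<lambda>s. Ahat s $$ (i, k)),
     set_A k j (\<lambda>s. Ahat s $$ (j, k))]) (filter (\<lambda>k. k \<noteq> i \<and> k \<noteq> j) [0..<n]))"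

definition jacobi_step5 :: "nat \<Rightarrow> nat \<Rightarrow> nat \<Rightarrow> assignment list" where
  "jacobi_step5 n i j = concat (map (\<lambda>k.
    [\<lambda>s. s\<lparr>var_tmp := Xmat s $$ (k, i)\<rparr>,
     set_X k i (\<lambda>s. var_cs s * var_tmp s - var_sn s * Xmat s $$ (k, j)),
     set_X k j (\<lambda>s. var_sn s * var_tmp s + var_cs s * Xmat s $$ (k, j))]) [0..<n])"

definition jacobi_iteration :: "nat \<Rightarrow> nat \<Rightarrow> nat \<Rightarrow> assignment list" where
  "jacobi_iteration n i j =
     jacobi_step1 i j @ jacobi_step2 @ jacobi_step3 i j @ jacobi_step4 n i j @ jacobi_step5 n i j"

definition jacobi_sweep :: "nat \<Rightarrow> assignment list" where
  "jacobi_sweep n =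
     concat (map (\<lambda>i. concat (map (\<lambda>j. jacobi_iteration n i j) [Suc i..<n])) [0..<n])"

definition jacobi_program :: "nat \<Rightarrow> assignment list" where
  "jacobi_program n = concat (replicate n (jacobi_sweep n))"

text \<open>The scalar variables have no value before they are first assigned. The placeholder 0 is
  never read: each iteration assigns them all in its first two steps, and
  \<^const>\<open>var_tmp\<close> immediately before each use.\<close>

definition jacobi_init :: "nat \<Rightarrow> real mat \<Rightarrow> jacobi_state" where
  "jacobi_init n M = \<lparr>Ahat = M, Xmat = 1\<^sub>m n, var_a = 0, var_b = 0, var_c = 0,
     var_t = 0, var_cs = 0, var_sn = 0, var_tmp = 0\<rparr>"

text \<open>\<open>jacobi_state_at n M p\<close> is the state after the first \<open>p\<close> assignments on input \<open>M\<close>.\<close>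

definition jacobi_state_at :: "nat \<Rightarrow> real mat \<Rightarrow> nat \<Rightarrow> jacobi_state" where
  "jacobi_state_at n M p = fold (\<lambda>f s. f s) (take p (jacobi_program n)) (jacobi_init n M)"

definition jacobi_eigenvalue :: "nat \<Rightarrow> real mat \<Rightarrow> nat \<Rightarrow> real" where
  "jacobi_eigenvalue n M i = Ahat (jacobi_state_at n M (length (jacobi_program n))) $$ (i, i)"

end

theory Submission
  imports Defs
begin

text \<open>
  A Jacobi rotation replaces the working matrix by $J^T \hat A J$ with $J$ orthogonal, so it
  preserves the property $0 \le v^T \hat A v \le v^T v$ for all $v$ (\<open>psd_contraction\<close>). That
  property alone bounds the entries: evaluated at a unit vector it puts each diagonal entry in
  $[0,1]$, and evaluated at $e_r \pm e_k$ it puts the off-diagonal entries in $[-1,1]$. The scaled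
  input has it because, for symmetric $A$, the two norms agree and
  $v^T A v \le \sum |a_{rk}| (v_r^2 + v_k^2) / 2 \le \|A\|_\infty v^T v$. The matrix $X$ is only
  ever multiplied by rotations on the right, so its rows stay unit vectors, and the bounds on
  $t$, $cs$ and $sn$ can be read off their formulas.

  Two points need more than this. First, step (3) does not compute $J^T \hat A J$ but writes $a - ct$,
  $b + ct$ and $0$ in the pivot block. These values are right because $t$ is a root of
  $c t^2 + (b - a) t - c$ (\<open>jacobi_tan_root\<close>, \<open>rot_congruence_pivot_block\<close>).
  Second, the bounds are claimed between any two assignments, where $\hat A$ is neither the old
  matrix $M$ nor the new matrix $N = J^T M J$. There every entry of $\hat A$ is the corresponding
  entry of $M$ or of $N$, and both matrices have bounded entries. The predicate \<open>partly_rotated\<close>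
  records which entries have been replaced, and also yields that step (4) ends with $N$:
  an entry is always read before it is overwritten. Similarly $X$ always has entries from
  rows before or after the rotation.

  Since the bounds are asserted at every point of the run, the program logic used here is that of
  Hoare triples with an additional assertion that holds throughout (\<open>triple\<close>).
\<close>

section \<open>Plane rotations of coordinate functions\<close>

text \<open>Coordinates are functions on the naturals, so that the rows and columns of a matrix and the
  argument of a quadratic form can be rotated by the same operation.\<close>

definition plane_rot :: "nat \<Rightarrow> nat \<Rightarrow> real \<Rightarrow> real \<Rightarrow> (nat \<Rightarrow> real) \<Rightarrow> nat \<Rightarrow> real" where
  "plane_rot i j cs sn f = f(i := cs * f i - sn * f j, j := sn * f i + cs * f j)"

lemma sum_remove_two:
  fixes f :: "nat \<Rightarrow> real"
  assumes "i < n" "j < n" "i \<noteq> j"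
  shows "(\<Sum>x<n. f x) = f i + f j + (\<Sum>x\<in>{..<n} - {i, j}. f x)"
proof -
  have "(\<Sum>x<n. f x) = f i + (\<Sum>x\<in>{..<n} - {i}. f x)"
    using assms by (intro sum.remove) auto
  also have "(\<Sum>x\<in>{..<n} - {i}. f x) = f j + (\<Sum>x\<in>{..<n} - {i} - {j}. f x)"
    using assms by (intro sum.remove) auto
  also have "{..<n} - {i} - {j} = {..<n} - {i, j}"
    by auto
  finally show ?thesis by simp
qed

text \<open>The transpose of a rotation is the rotation with the opposite sine.\<close>

lemma plane_rot_adjoint:
  assumes "i < n" "j < n" "i \<noteq> j"
  shows "(\<Sum>x<n. v x * plane_rot i j cs sn f x) = (\<Sum>x<n. plane_rot i j cs (- sn) v x * f x)"
proof -
  have "(\<Sum>x\<in>{..<n} - {i, j}. v x * plane_rot i j cs sn f x)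
      = (\<Sum>x\<in>{..<n} - {i, j}. plane_rot i j cs (- sn) v x * f x)"
    by (intro sum.cong) (auto simp: plane_rot_def)
  then show ?thesis
    using assms by (simp add: sum_remove_two[OF assms] plane_rot_def algebra_simps)
qed

lemma plane_rot_sum_squares:
  assumes "i < n" "j < n" "i \<noteq> j" and unit: "cs\<^sup>2 + sn\<^sup>2 = 1"
  shows "(\<Sum>x<n. (plane_rot i j cs sn f x)\<^sup>2) = (\<Sum>x<n. (f x)\<^sup>2)"
proof -
  have rest: "(\<Sum>x\<in>{..<n} - {i, j}. (plane_rot i j cs sn f x)\<^sup>2) = (\<Sum>x\<in>{..<n} - {i, j}. (f x)\<^sup>2)"
    by (intro sum.cong) (auto simp: plane_rot_def)
  have "(cs * f i - sn * f j)\<^sup>2 + (sn * f i + cs * f j)\<^sup>2 = (cs\<^sup>2 + sn\<^sup>2) * ((f i)\<^sup>2 + (f j)\<^sup>2)"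
    by (simp add: power2_eq_square algebra_simps)
  then show ?thesis
    using assms rest by (simp add: sum_remove_two[OF assms(1-3)] plane_rot_def)
qed


section \<open>Symmetric forms between zero and the identity\<close>

definition quad_form :: "nat \<Rightarrow> (nat \<Rightarrow> nat \<Rightarrow> real) \<Rightarrow> (nat \<Rightarrow> real) \<Rightarrow> real" where
  "quad_form n M v = (\<Sum>r<n. v r * (\<Sum>k<n. v k * M r k))"

definition psd_contraction :: "nat \<Rightarrow> (nat \<Rightarrow> nat \<Rightarrow> real) \<Rightarrow> bool" where
  "psd_contraction n M \<longleftrightarrow> (\<forall>r<n. \<forall>k<n. M r k = M k r) \<and>
     (\<forall>v. 0 \<le> quad_form n M v \<and> quad_form n M v \<le> (\<Sum>r<n. (v r)\<^sup>2))"

lemma psd_contraction_diag: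
  assumes "psd_contraction n M" "r < n"
  shows "M r r \<in> {0..1}"
proof -
  define v :: "nat \<Rightarrow> real" where "v = (\<lambda>x. if x = r then 1 else 0)"
  have pick: "(\<Sum>x<n. v x * f x) = f r" for f
  proof -
    have "(\<Sum>x<n. v x * f x) = (\<Sum>x<n. if x = r then f x else 0)"
      by (intro sum.cong) (auto simp: v_def)
    then show ?thesis
      using assms(2) by simp
  qed
  have "(v x)\<^sup>2 = v x * 1" for x
    by (simp add: v_def)
  then have "(\<Sum>x<n. (v x)\<^sup>2) = 1"
    using pick[of "\<lambda>_. 1"] by simp
  moreover have "quad_form n M v = M r r"
    by (simp add: quad_form_def pick)
  ultimately show ?thesis
    using assms(1) unfolding psd_contraction_def by (metis atLeastAtMost_iff)
qed

text \<open>Evaluating the form at $e_r + \sigma e_k$ with $\sigma = \pm 1$ and using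
  that it is nonnegative gives $|2 M_{rk}| \le M_{rr} + M_{kk} \le 2$.\<close>

lemma psd_contraction_entry:
  assumes "psd_contraction n M" "r < n" "k < n"
  shows "M r k \<in> {-1..1}"
proof (cases "r = k")
  case True
  then show ?thesis
    using psd_contraction_diag[OF assms(1,2)] by auto
next
  case False
  have sym: "M k r = M r k"
    using assms by (simp add: psd_contraction_def)
  have nonneg: "0 \<le> M r r + M k k + 2 * \<sigma> * M r k" if "\<sigma> = 1 \<or> \<sigma> = -1" for \<sigma>
  proof -
    define v :: "nat \<Rightarrow> real" where "v = (\<lambda>x. 0)(r := 1, k := \<sigma>)"
    have pick: "(\<Sum>x<n. v x * f x) = f r + \<sigma> * f k" for f
    proof -
      have "(\<Sum>x\<in>{..<n} - {r, k}. v x * f x) = 0"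
        by (intro sum.neutral) (auto simp: v_def)
      then show ?thesis
        using False by (simp add: sum_remove_two[OF assms(2,3)] v_def)
    qed
    have "quad_form n M v = M r r + M k k + 2 * \<sigma> * M r k"
      using sym that by (auto simp: quad_form_def pick)
    then show ?thesis
      using assms(1) unfolding psd_contraction_def by metis
  qed
  show ?thesis
    using nonneg[of 1] nonneg[of "-1"] psd_contraction_diag[OF assms(1,2)]
      psd_contraction_diag[OF assms(1,3)] by auto
qed

text \<open>This is $J^T M J$, where $J^T$ acts on a column as \<open>plane_rot i j cs sn\<close>: the inner
  rotation combines rows $i$ and $j$, the outer one combines columns $i$ and $j$.\<close>

definition rot_congruence ::
    "nat \<Rightarrow> nat \<Rightarrow> real \<Rightarrow> real \<Rightarrow> (nat \<Rightarrow> nat \<Rightarrow> real) \<Rightarrow> nat \<Rightarrow> nat \<Rightarrow> real" where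
  "rot_congruence i j cs sn M r k =
     plane_rot i j cs sn (\<lambda>k'. plane_rot i j cs sn (\<lambda>r'. M r' k') r) k"

text \<open>$v^T (J^T M J) v = (J v)^T M (J v)$, by moving the two rotations one after the other to $v$.\<close>

lemma quad_form_rot_congruence:
  assumes "i < n" "j < n" "i \<noteq> j"
  shows "quad_form n (rot_congruence i j cs sn M) v = quad_form n M (plane_rot i j cs (- sn) v)"
proof -
  let ?w = "plane_rot i j cs (- sn) v"
  have "quad_form n (rot_congruence i j cs sn M) v
      = (\<Sum>r<n. v r * (\<Sum>k<n. ?w k * plane_rot i j cs sn (\<lambda>r'. M r' k) r))"
    by (simp add: quad_form_def rot_congruence_def plane_rot_adjoint[OF assms])
  also have "\<dots> = (\<Sum>k<n. ?w k * (\<Sum>r<n. v r * plane_rot i j cs sn (\<lambda>r'. M r' k) r))"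
    unfolding sum_distrib_left by (subst sum.swap) (simp add: mult.left_commute)
  also have "\<dots> = (\<Sum>k<n. ?w k * (\<Sum>r<n. ?w r * M r k))"
    by (simp add: plane_rot_adjoint[OF assms])
  also have "\<dots> = quad_form n M ?w"
    unfolding quad_form_def sum_distrib_left by (subst sum.swap) (simp add: mult.left_commute)
  finally show ?thesis .
qed

text \<open>Replacing $v$ by $J v$ changes neither the sign condition nor $v^T v$.\<close>

lemma psd_contraction_rot_congruence:
  assumes "psd_contraction n M" and ij: "i < n" "j < n" "i \<noteq> j" and unit: "cs\<^sup>2 + sn\<^sup>2 = 1"
  shows "psd_contraction n (rot_congruence i j cs sn M)"
proof -
  have sym: "M r k = M k r" if "r < n" "k < n" for r k
    using assms(1) that by (auto simp: psd_contraction_def)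
  have "rot_congruence i j cs sn M r k = rot_congruence i j cs sn M k r" if "r < n" "k < n" for r k
  proof -
    \<comment> \<open>Rotating rows commutes with rotating columns.\<close>
    have "rot_congruence i j cs sn M r k = rot_congruence i j cs sn (\<lambda>r k. M k r) k r"
      by (auto simp: rot_congruence_def plane_rot_def algebra_simps)
    also have "\<dots> = rot_congruence i j cs sn M k r"
      using ij that sym by (simp add: rot_congruence_def plane_rot_def)
    finally show ?thesis .
  qed
  moreover have "(\<Sum>r<n. (plane_rot i j cs (- sn) v r)\<^sup>2) = (\<Sum>r<n. (v r)\<^sup>2)" for v
    using plane_rot_sum_squares[OF ij, of cs "- sn"] unit by simp
  ultimately show ?thesis
    using assms(1) unfolding psd_contraction_def quad_form_rot_congruence[OF ij] by metis
qed


section \<open>The Jacobi angle\<close>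

lemma jacobi_tan_abs_le_1: "\<bar>jacobi_tan a b c\<bar> \<le> 1"
proof (cases "c = 0")
  case False
  define D where "D = \<bar>(b - a) / 2\<bar> + sqrt (c\<^sup>2 + ((b - a) / 2)\<^sup>2)"
  have "\<bar>c\<bar> \<le> sqrt (c\<^sup>2 + ((b - a) / 2)\<^sup>2)"
    by (rule real_le_rsqrt) simp
  then have le: "\<bar>c\<bar> \<le> D"
    unfolding D_def by linarith
  moreover have "\<bar>jacobi_tan a b c\<bar> = \<bar>c\<bar> / \<bar>D\<bar>"
    using False by (simp add: jacobi_tan_def D_def sign1_def)
  moreover have "0 < D"
    using le False by linarith
  ultimately show ?thesis
    by simp
qed (simp add: jacobi_tan_def)

text \<open>Let $c \ne 0$. With $d = (b - a) / 2$ and $h = \sqrt{c^2 + d^2}$ the roots of $c x^2 + 2 d x - c$ are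
  $(-d \pm h) / c$. The formula for $t$ is the one of smaller modulus, rationalized to
  $\sigma / (|d| + h)$ with $\sigma = \pm c$. The sign convention gives $\sigma d = c |d|$, also for
  $d = 0$, where both signs yield a root.\<close>

lemma jacobi_tan_root: "c * (jacobi_tan a b c)\<^sup>2 + (b - a) * jacobi_tan a b c - c = 0"
proof (cases "c = 0")
  case False
  define d where "d = (b - a) / 2"
  define h where "h = sqrt (c\<^sup>2 + d\<^sup>2)"
  define \<sigma> where "\<sigma> = sign1 ((b - a) / c) * \<bar>c\<bar>"
  define D where "D = \<bar>d\<bar> + h"
  define t where "t = jacobi_tan a b c"
  have h: "h\<^sup>2 = c\<^sup>2 + d\<^sup>2" "h > 0"
    using False by (auto simp: h_def sum_power2_gt_zero_iff)
  then have D: "D > 0"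
    unfolding D_def by linarith
  have \<sigma>: "\<sigma> = t * D"
    using False D by (simp add: t_def jacobi_tan_def \<sigma>_def d_def h_def D_def)
  have sq: "\<sigma>\<^sup>2 = c\<^sup>2"
    by (simp add: \<sigma>_def sign1_def power_mult_distrib)
  have sd: "\<sigma> * d = c * \<bar>d\<bar>"
    using False by (auto simp: \<sigma>_def d_def sign1_def abs_if divide_less_0_iff)
  have "D\<^sup>2 * (c * t\<^sup>2 + 2 * d * t - c) = c * \<sigma>\<^sup>2 + 2 * (\<sigma> * d) * D - c * D\<^sup>2"
    by (simp add: \<sigma> power2_eq_square algebra_simps)
  also have "\<dots> = c * (c\<^sup>2 + \<bar>d\<bar>\<^sup>2 - h\<^sup>2)"
    unfolding sq sd D_def by (simp add: power2_eq_square algebra_simps)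
  also have "\<dots> = 0"
    by (simp add: h)
  finally have "c * t\<^sup>2 + 2 * d * t - c = 0"
    using D by simp
  moreover have "2 * d = b - a"
    by (simp add: d_def)
  ultimately show ?thesis
    by (simp add: t_def)
qed (simp add: jacobi_tan_def)

lemma cos_sin_of_tan:
  fixes t :: real
  assumes "cs = 1 / sqrt (1 + t\<^sup>2)" "sn = cs * t"
  shows "cs\<^sup>2 + sn\<^sup>2 = 1" and "cs \<in> {0..1}" and "sn \<in> {-1..1}"
proof -
  have pos: "0 < 1 + t\<^sup>2"
    by (simp add: add_pos_nonneg)
  have "cs\<^sup>2 = 1 / (1 + t\<^sup>2)"
    using assms(1) pos by (simp add: power_divide)
  moreover have "cs\<^sup>2 + sn\<^sup>2 = cs\<^sup>2 * (1 + t\<^sup>2)"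
    by (simp add: assms(2) power_mult_distrib algebra_simps)
  ultimately show unit: "cs\<^sup>2 + sn\<^sup>2 = 1"
    using pos by simp
  have "cs\<^sup>2 \<le> 1" "sn\<^sup>2 \<le> 1"
    using unit zero_le_power2[of cs] zero_le_power2[of sn] by linarith+
  then have "\<bar>cs\<bar> \<le> 1" "\<bar>sn\<bar> \<le> 1"
    by (simp_all add: abs_square_le_1)
  moreover have "0 \<le> cs"
    using assms(1) pos by simp
  ultimately show "cs \<in> {0..1}" "sn \<in> {-1..1}"
    by auto
qed

text \<open>Each difference between an entry of $J^T M J$ and the value that the algorithm assigns to it
  is a multiple of $c t^2 + (b - a) t - c$, where $a$, $b$, $c$ are the entries of the pivot block.\<close>

lemma rot_congruence_pivot_block:
  assumes t: "t = jacobi_tan (M i i) (M j j) (M i j)"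
    and cs: "cs = 1 / sqrt (1 + t\<^sup>2)" and sn: "sn = cs * t"
    and ij: "i \<noteq> j" and sym: "M j i = M i j"
  shows "rot_congruence i j cs sn M i i = M i i - M i j * t"
    and "rot_congruence i j cs sn M j j = M j j + M i j * t"
    and "rot_congruence i j cs sn M i j = 0"
    and "rot_congruence i j cs sn M j i = 0"
proof -
  let ?a = "M i i" and ?b = "M j j" and ?c = "M i j"
  have root: "?c * t\<^sup>2 + (?b - ?a) * t - ?c = 0"
    unfolding t by (rule jacobi_tan_root)
  have unit: "cs\<^sup>2 * (1 + t\<^sup>2) = 1"
    using cos_sin_of_tan(1)[OF cs sn] by (simp add: sn power_mult_distrib algebra_simps)
  have "rot_congruence i j cs sn M i i = cs\<^sup>2 * (?a - 2 * ?c * t + ?b * t\<^sup>2)"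
    using ij sym by (simp add: rot_congruence_def plane_rot_def sn power2_eq_square algebra_simps)
  also have "?a - 2 * ?c * t + ?b * t\<^sup>2
      = (1 + t\<^sup>2) * (?a - ?c * t) + t * (?c * t\<^sup>2 + (?b - ?a) * t - ?c)"
    by (simp add: power2_eq_square algebra_simps)
  also have "cs\<^sup>2 * \<dots> = (cs\<^sup>2 * (1 + t\<^sup>2)) * (?a - ?c * t)"
    unfolding root by simp
  finally show "rot_congruence i j cs sn M i i = ?a - ?c * t"
    by (simp add: unit)
  have "rot_congruence i j cs sn M j j = cs\<^sup>2 * (?a * t\<^sup>2 + 2 * ?c * t + ?b)"
    using ij sym by (simp add: rot_congruence_def plane_rot_def sn power2_eq_square algebra_simps)
  also have "?a * t\<^sup>2 + 2 * ?c * t + ?b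
      = (1 + t\<^sup>2) * (?b + ?c * t) - t * (?c * t\<^sup>2 + (?b - ?a) * t - ?c)"
    by (simp add: power2_eq_square algebra_simps)
  also have "cs\<^sup>2 * \<dots> = (cs\<^sup>2 * (1 + t\<^sup>2)) * (?b + ?c * t)"
    unfolding root by simp
  finally show "rot_congruence i j cs sn M j j = ?b + ?c * t"
    by (simp add: unit)
  have "rot_congruence i j cs sn M i j = - cs\<^sup>2 * (?c * t\<^sup>2 + (?b - ?a) * t - ?c)"
    using ij sym by (simp add: rot_congruence_def plane_rot_def sn power2_eq_square algebra_simps)
  then show "rot_congruence i j cs sn M i j = 0"
    unfolding root by simp
  have "rot_congruence i j cs sn M j i = - cs\<^sup>2 * (?c * t\<^sup>2 + (?b - ?a) * t - ?c)"
    using ij sym by (simp add: rot_congruence_def plane_rot_def sn power2_eq_square algebra_simps)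
  then show "rot_congruence i j cs sn M j i = 0"
    unfolding root by simp
qed


section \<open>Assertions that hold throughout a run\<close>

abbreviation exec :: "('s \<Rightarrow> 's) list \<Rightarrow> 's \<Rightarrow> 's" where
  "exec fs \<equiv> fold (\<lambda>f s. f s) fs"

definition throughout :: "('s \<Rightarrow> bool) \<Rightarrow> ('s \<Rightarrow> 's) list \<Rightarrow> 's \<Rightarrow> bool" where
  "throughout B fs s \<longleftrightarrow> (\<forall>p\<le>length fs. B (exec (take p fs) s))"

text \<open>Between two assignments of a loop body the loop invariant fails, while the claimed bounds
  still hold. Hence \<open>B\<close> is kept apart from the pre- and postcondition.\<close>

definition triple ::
    "('s \<Rightarrow> bool) \<Rightarrow> ('s \<Rightarrow> bool) \<Rightarrow> ('s \<Rightarrow> 's) list \<Rightarrow> ('s \<Rightarrow> bool) \<Rightarrow> bool" where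
  "triple B P fs Q \<longleftrightarrow> (\<forall>s. P s \<longrightarrow> throughout B fs s \<and> Q (exec fs s))"

lemma throughout_Nil [simp]: "throughout B [] s \<longleftrightarrow> B s"
  by (simp add: throughout_def)

lemma throughout_Cons [simp]: "throughout B (f # fs) s \<longleftrightarrow> B s \<and> throughout B fs (f s)"
proof -
  have "(\<forall>p\<le>Suc n. P p) \<longleftrightarrow> P 0 \<and> (\<forall>p\<le>n. P (Suc p))" for P n
    using All_less_Suc2[of "Suc n" P] unfolding less_Suc_eq_le .
  from this[of "length fs" "\<lambda>p. B (exec (take p (f # fs)) s)"] show ?thesis
    by (simp add: throughout_def)
qed

lemma throughout_append:
  "throughout B (fs @ gs) s \<longleftrightarrow> throughout B fs s \<and> throughout B gs (exec fs s)"
proof (induction fs arbitrary: s)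
  case Nil
  then show ?case by (cases gs) auto
qed simp

lemma triple_append:
  "triple B P fs R \<Longrightarrow> triple B R gs Q \<Longrightarrow> triple B P (fs @ gs) Q"
  by (auto simp: triple_def throughout_append)

lemma triple_loop:
  assumes step: "\<And>k K. k \<in> set ks \<Longrightarrow> k \<notin> K \<Longrightarrow> triple B (I K) (body k) (I (insert k K))"
    and safe: "\<And>K s. I K s \<Longrightarrow> B s" and "distinct ks"
  shows "triple B (I {}) (concat (map body ks)) (I (set ks))"
proof -
  have "triple B (I K) (concat (map body ks)) (I (K \<union> set ks))"
    if "distinct ks" "set ks \<inter> K = {}" "\<And>k K. k \<in> set ks \<Longrightarrow> k \<notin> K \<Longrightarrow> triple B (I K) (body k) (I (insert k K))"
    for K ks
    using that
  proof (induction ks arbitrary: K)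
    case Nil
    then show ?case using safe by (simp add: triple_def)
  next
    case (Cons k ks)
    have "triple B (I K) (body k) (I (insert k K))"
      using Cons.prems by auto
    moreover have "triple B (I (insert k K)) (concat (map body ks)) (I (insert k K \<union> set ks))"
      using Cons.prems by (intro Cons.IH) auto
    ultimately show ?case
      using triple_append by fastforce
  qed
  from this[of ks "{}"] show ?thesis
    using assms by simp
qed

lemma triple_concat_invariant:
  assumes "\<And>fs. fs \<in> set fss \<Longrightarrow> triple B P fs P" and "\<And>s. P s \<Longrightarrow> B s"
  shows "triple B P (concat fss) P"
  using assms(1)
proof (induction fss)
  case Nil
  then show ?case using assms(2) by (simp add: triple_def)
next
  case (Cons fs fss)
  then show ?case by (auto intro: triple_append)
qed


section \<open>The bounds during one iteration\<close>

lemma mat_upd_carrier [simp]: "mat_upd M r k x \<in> carrier_mat n n' \<longleftrightarrow> M \<in> carrier_mat n n'"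
  unfolding mat_upd_def carrier_mat_def by simp

lemma index_mat_upd:
  assumes "M \<in> carrier_mat n n'" "r < n" "k < n'"
  shows "mat_upd M r0 k0 x $$ (r, k) = (if r = r0 \<and> k = k0 then x else M $$ (r, k))"
  using assms(2,3) carrier_matD[OF assms(1)] by (simp add: mat_upd_def)

definition entries_bounded :: "nat \<Rightarrow> real mat \<Rightarrow> bool" where
  "entries_bounded n M \<longleftrightarrow> M \<in> carrier_mat n n \<and> (\<forall>r<n. \<forall>k<n. M $$ (r, k) \<in> {-1..1})"

lemma entries_bounded_mat_upd:
  assumes "entries_bounded n M" "x \<in> {-1..1}"
  shows "entries_bounded n (mat_upd M r k x)"
proof -
  have "M \<in> carrier_mat n n"
    using assms(1) by (simp add: entries_bounded_def)
  from index_mat_upd[OF this, of _ _ r k x] show ?thesis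
    using assms by (simp add: entries_bounded_def)
qed

definition safe :: "nat \<Rightarrow> jacobi_state \<Rightarrow> bool" where
  "safe n s \<longleftrightarrow> entries_bounded n (Ahat s) \<and> entries_bounded n (Xmat s) \<and>
     var_t s \<in> {-1..1} \<and> var_cs s \<in> {0..1} \<and> var_sn s \<in> {-1..1} \<and>
     var_a s \<in> {0..1} \<and> var_b s \<in> {0..1} \<and> var_c s \<in> {-1..1}"

definition unit_rows :: "nat \<Rightarrow> real mat \<Rightarrow> bool" where
  "unit_rows n X \<longleftrightarrow> X \<in> carrier_mat n n \<and> (\<forall>r<n. (\<Sum>k<n. (X $$ (r, k))\<^sup>2) = 1)"

lemma entry_of_unit_vector:
  fixes f :: "nat \<Rightarrow> real"
  assumes "(\<Sum>x<n. (f x)\<^sup>2) = 1" "k < n"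
  shows "f k \<in> {-1..1}"
proof -
  have "(f k)\<^sup>2 \<le> (\<Sum>x<n. (f x)\<^sup>2)"
    using assms(2) by (intro member_le_sum) auto
  then have "\<bar>f k\<bar> \<le> 1"
    using assms(1) by (simp add: abs_square_le_1)
  then show ?thesis by auto
qed

lemma unit_rows_bounded:
  assumes "unit_rows n X"
  shows "entries_bounded n X"
proof -
  have "X $$ (r, k) \<in> {-1..1}" if "r < n" "k < n" for r k
    using entry_of_unit_vector[of "\<lambda>k. X $$ (r, k)" n k] assms that by (simp add: unit_rows_def)
  then show ?thesis
    using assms by (simp add: entries_bounded_def unit_rows_def)
qed

definition mat_fun :: "real mat \<Rightarrow> nat \<Rightarrow> nat \<Rightarrow> real" where
  "mat_fun M r k = M $$ (r, k)"

text \<open>What every iteration preserves. The scalar variables enter only through \<open>safe\<close>, because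
  each iteration assigns them before reading them.\<close>

definition iteration_inv :: "nat \<Rightarrow> jacobi_state \<Rightarrow> bool" where
  "iteration_inv n s \<longleftrightarrow> safe n s \<and> psd_contraction n (mat_fun (Ahat s)) \<and> unit_rows n (Xmat s)"

text \<open>The situation during step (4), when the indices in \<open>K\<close> have been processed: the pivot block
  and the rows and columns $i$, $j$ at the positions in \<open>K\<close> already belong to the rotated matrix,
  and the other entries still belong to \<open>M\<close>.\<close>

definition partly_rotated ::
    "nat \<Rightarrow> nat \<Rightarrow> nat \<Rightarrow> real \<Rightarrow> real \<Rightarrow> (nat \<Rightarrow> nat \<Rightarrow> real) \<Rightarrow> nat set \<Rightarrow> jacobi_state \<Rightarrow> bool" where
  "partly_rotated n i j cs sn M K s \<longleftrightarrow>
     safe n s \<and> unit_rows n (Xmat s) \<and> var_cs s = cs \<and> var_sn s = sn \<and>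
     (\<forall>r<n. \<forall>k<n. Ahat s $$ (r, k) =
        (if r \<in> {i, j} \<and> k \<in> {i, j} \<union> K \<or> k \<in> {i, j} \<and> r \<in> K
         then rot_congruence i j cs sn M r k else M r k))"

text \<open>After step (3) the rotated entries are those of the pivot block. The initial state is fixed
  because the later steps compare the working matrix with its value \<open>M\<close> at the start.\<close>

lemma triple_steps_1_to_3:
  assumes inv: "iteration_inv n s\<^sub>0" and ij: "i < n" "j < n" "i \<noteq> j"
    and M: "M = mat_fun (Ahat s\<^sub>0)"
    and t: "t = jacobi_tan (M i i) (M j j) (M i j)"
    and cs: "cs = 1 / sqrt (1 + t\<^sup>2)" and sn: "sn = cs * t"
  shows "triple (safe n) (\<lambda>s. s = s\<^sub>0) (jacobi_step1 i j @ jacobi_step2 @ jacobi_step3 i j)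
           (partly_rotated n i j cs sn M {})"
proof -
  let ?N = "rot_congruence i j cs sn M"
  have contr: "psd_contraction n M" and safe: "safe n s\<^sub>0" and unit: "unit_rows n (Xmat s\<^sub>0)"
    using inv M by (auto simp: iteration_inv_def)
  have carrier: "Ahat s\<^sub>0 \<in> carrier_mat n n"
    using safe by (simp add: safe_def entries_bounded_def)
  have entry: "Ahat s\<^sub>0 $$ (r, k) = M r k" for r k
    by (simp add: M mat_fun_def)
  have contrN: "psd_contraction n ?N"
    using psd_contraction_rot_congruence[OF contr ij] cos_sin_of_tan(1)[OF cs sn] by blast
  have sym: "M j i = M i j"
    using contr ij by (simp add: psd_contraction_def)
  note N = rot_congruence_pivot_block[OF t cs sn ij(3) sym]
  have trig: "t \<in> {-1..1}" "cs \<in> {0..1}" "sn \<in> {-1..1}"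
    using jacobi_tan_abs_le_1[of "M i i" "M j j" "M i j"] cos_sin_of_tan(2,3)[OF cs sn]
    by (auto simp: t abs_le_iff)
  have old: "M i i \<in> {0..1}" "M j j \<in> {0..1}" "M i j \<in> {-1..1}"
    using psd_contraction_diag[OF contr] psd_contraction_entry[OF contr] ij by blast+
  have new: "M i i - M i j * t \<in> {-1..1}" "M j j + M i j * t \<in> {-1..1}" "(0::real) \<in> {-1..1}"
    using psd_contraction_entry[OF contrN] ij N(1,2) by (metis, metis, simp)
  let ?fs = "jacobi_step1 i j @ jacobi_step2 @ jacobi_step3 i j"
  have "throughout (safe n) ?fs s\<^sub>0"
    using safe old trig new
    by (simp add: jacobi_step1_def jacobi_step2_def jacobi_step3_def set_A_def safe_def entry
        entries_bounded_mat_upd flip: t cs sn del: atLeastAtMost_iff)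
  moreover have "safe n (exec ?fs s\<^sub>0)"
    using safe old trig new
    by (simp add: jacobi_step1_def jacobi_step2_def jacobi_step3_def set_A_def safe_def entry
        entries_bounded_mat_upd flip: t cs sn del: atLeastAtMost_iff)
  then have "partly_rotated n i j cs sn M {} (exec ?fs s\<^sub>0)"
    using unit carrier ij N
    by (auto simp: partly_rotated_def jacobi_step1_def jacobi_step2_def jacobi_step3_def set_A_def
        entry index_mat_upd[where n = n and n' = n] simp flip: t cs sn)
  ultimately show ?thesis
    by (simp add: triple_def)
qed

text \<open>The pass for index \<open>k\<close> reads only the entries at $(i,k)$ and $(j,k)$, which no other pass
  touches, so it finds their old values. It writes only entries of the rotated matrix, and these
  are bounded.\<close>

lemma triple_step_4:
  assumes contr: "psd_contraction n M" and ij: "i < n" "j < n" "i \<noteq> j"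
    and unit: "cs\<^sup>2 + sn\<^sup>2 = 1"
  shows "triple (safe n) (partly_rotated n i j cs sn M {}) (jacobi_step4 n i j)
           (partly_rotated n i j cs sn M ({..<n} - {i, j}))"
proof -
  let ?N = "rot_congruence i j cs sn M"
  let ?body = "\<lambda>k. [\<lambda>s. s\<lparr>var_tmp := Ahat s $$ (i, k)\<rparr>,
     set_A i k (\<lambda>s. var_cs s * var_tmp s - var_sn s * Ahat s $$ (j, k)),
     set_A j k (\<lambda>s. var_sn s * var_tmp s + var_cs s * Ahat s $$ (j, k)),
     set_A k i (\<lambda>s. Ahat s $$ (i, k)),
     set_A k j (\<lambda>s. Ahat s $$ (j, k))]"
  let ?ks = "filter (\<lambda>k. k \<noteq> i \<and> k \<noteq> j) [0..<n]"
  have contrN: "psd_contraction n ?N"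
    by (rule psd_contraction_rot_congruence[OF contr ij unit])
  have "triple (safe n) (partly_rotated n i j cs sn M K) (?body k)
          (partly_rotated n i j cs sn M (insert k K))"
    if "k \<in> set ?ks" and new: "k \<notin> K" for k K
    unfolding triple_def
  proof (intro allI impI)
    fix s
    assume s: "partly_rotated n i j cs sn M K s"
    have k: "k < n" "k \<noteq> i" "k \<noteq> j"
      using that by auto
    have safe: "safe n s" and [simp]: "var_cs s = cs" "var_sn s = sn"
      using s by (auto simp: partly_rotated_def)
    have carrier: "Ahat s \<in> carrier_mat n n"
      using safe by (simp add: safe_def entries_bounded_def)
    note upd = index_mat_upd[where n = n and n' = n]
    have read: "Ahat s $$ (i, k) = M i k" "Ahat s $$ (j, k) = M j k"
      using s ij k new by (auto simp: partly_rotated_def)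
    have N: "cs * M i k - sn * M j k = ?N i k" "sn * M i k + cs * M j k = ?N j k"
      using ij k by (auto simp: rot_congruence_def plane_rot_def)
    \<comment> \<open>Copying the two new entries to column positions is correct because the rotated matrix is symmetric.\<close>
    have sym: "?N k i = ?N i k" "?N k j = ?N j k"
      using contrN ij k by (auto simp: psd_contraction_def)
    have bounds: "?N i k \<in> {-1..1}" "?N j k \<in> {-1..1}"
      using psd_contraction_entry[OF contrN] ij k by blast+
    let ?A = "mat_upd (mat_upd (mat_upd (mat_upd (Ahat s) i k (?N i k)) j k (?N j k))
                k i (?N i k)) k j (?N j k)"
    have result: "exec (?body k) s = s\<lparr>var_tmp := M i k, Ahat := ?A\<rparr>"
      using ij k carrier by (simp add: set_A_def read N upd)
    have "throughout (safe n) (?body k) s"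
      using safe ij k carrier bounds
      by (simp add: set_A_def safe_def read N upd entries_bounded_mat_upd del: atLeastAtMost_iff)
    moreover have "safe n (exec (?body k) s)"
      using safe bounds unfolding result
      by (simp add: safe_def entries_bounded_mat_upd del: atLeastAtMost_iff)
    moreover have "?A $$ (r, q) =
        (if r \<in> {i, j} \<and> q \<in> {i, j} \<union> insert k K \<or> q \<in> {i, j} \<and> r \<in> insert k K
         then ?N r q else M r q)" if "r < n" "q < n" for r q
      using s ij k carrier that sym by (auto simp: upd partly_rotated_def)
    ultimately show "throughout (safe n) (?body k) s \<and>
        partly_rotated n i j cs sn M (insert k K) (exec (?body k) s)"
      using s unfolding result by (simp add: partly_rotated_def)
  qed
  then have "triple (safe n) (partly_rotated n i j cs sn M {}) (concat (map ?body ?ks))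
      (partly_rotated n i j cs sn M (set ?ks))"
    by (rule triple_loop) (auto simp: partly_rotated_def)
  moreover have "set ?ks = {..<n} - {i, j}"
    by auto
  ultimately show ?thesis
    by (simp add: jacobi_step4_def)
qed

lemma psd_contraction_cong:
  assumes "\<And>r k. r < n \<Longrightarrow> k < n \<Longrightarrow> M r k = N r k"
  shows "psd_contraction n M \<longleftrightarrow> psd_contraction n N"
  using assms by (simp add: psd_contraction_def quad_form_def)

text \<open>The entries outside the rows and columns $i$ and $j$ are the same before and after the rotation,
  so at the end of step (4) the whole matrix is the rotated one.\<close>

lemma partly_rotated_all:
  assumes "psd_contraction n M" "i < n" "j < n" "i \<noteq> j" "cs\<^sup>2 + sn\<^sup>2 = 1"
    and "partly_rotated n i j cs sn M ({..<n} - {i, j}) s"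
  shows "psd_contraction n (mat_fun (Ahat s))"
proof -
  have "mat_fun (Ahat s) r k = rot_congruence i j cs sn M r k" if "r < n" "k < n" for r k
    using assms(6) that
    by (auto simp: partly_rotated_def mat_fun_def) (auto simp: rot_congruence_def plane_rot_def)
  then show ?thesis
    using psd_contraction_rot_congruence[OF assms(1-5)] psd_contraction_cong by metis
qed

text \<open>The pass for index \<open>k\<close> rotates row \<open>k\<close> of \<open>X\<close> as a vector, which keeps its length. Hence
  \<open>unit_rows\<close> is itself a loop invariant.\<close>

lemma triple_step_5:
  assumes ij: "i < n" "j < n" "i \<noteq> j"
  defines "P \<equiv> \<lambda>s. iteration_inv n s \<and> (var_cs s)\<^sup>2 + (var_sn s)\<^sup>2 = 1"
  shows "triple (safe n) P (jacobi_step5 n i j) P"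
  unfolding jacobi_step5_def
proof (rule triple_concat_invariant)
  fix fs
  assume "fs \<in> set (map (\<lambda>k. [\<lambda>s. s\<lparr>var_tmp := Xmat s $$ (k, i)\<rparr>,
     set_X k i (\<lambda>s. var_cs s * var_tmp s - var_sn s * Xmat s $$ (k, j)),
     set_X k j (\<lambda>s. var_sn s * var_tmp s + var_cs s * Xmat s $$ (k, j))]) [0..<n])"
  then obtain k where k: "k < n" and fs: "fs = [\<lambda>s. s\<lparr>var_tmp := Xmat s $$ (k, i)\<rparr>,
     set_X k i (\<lambda>s. var_cs s * var_tmp s - var_sn s * Xmat s $$ (k, j)),
     set_X k j (\<lambda>s. var_sn s * var_tmp s + var_cs s * Xmat s $$ (k, j))]"
    by auto
  show "triple (safe n) P fs P"
    unfolding triple_def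
  proof (intro allI impI)
    fix s
    assume s: "P s"
    define row where "row = plane_rot i j (var_cs s) (var_sn s) (\<lambda>q. Xmat s $$ (k, q))"
    have safe: "safe n s" and unit: "unit_rows n (Xmat s)"
      using s by (auto simp: P_def iteration_inv_def)
    have carrier: "Xmat s \<in> carrier_mat n n"
      using unit by (simp add: unit_rows_def)
    note upd = index_mat_upd[where n = n and n' = n]
    have row_unit: "(\<Sum>q<n. (row q)\<^sup>2) = 1"
      using s k unit plane_rot_sum_squares[OF ij] by (simp add: row_def P_def unit_rows_def)
    have row: "var_cs s * Xmat s $$ (k, i) - var_sn s * Xmat s $$ (k, j) = row i"
        "var_sn s * Xmat s $$ (k, i) + var_cs s * Xmat s $$ (k, j) = row j"
      using ij by (auto simp: row_def plane_rot_def)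
    have bounds: "row i \<in> {-1..1}" "row j \<in> {-1..1}"
      using entry_of_unit_vector[OF row_unit] ij by blast+
    let ?X = "mat_upd (mat_upd (Xmat s) k i (row i)) k j (row j)"
    have result: "exec fs s = s\<lparr>var_tmp := Xmat s $$ (k, i), Xmat := ?X\<rparr>"
      using ij k carrier by (simp add: fs set_X_def row upd)
    have "throughout (safe n) fs s"
      using safe ij k carrier bounds
      by (simp add: fs set_X_def safe_def row upd entries_bounded_mat_upd del: atLeastAtMost_iff)
    moreover have "safe n (exec fs s)"
      using safe bounds unfolding result
      by (simp add: safe_def entries_bounded_mat_upd del: atLeastAtMost_iff)
    moreover have "unit_rows n ?X"
      unfolding unit_rows_def
    proof (intro conjI allI impI)
      fix r
      assume r: "r < n"
      have "?X $$ (r, q) = (if r = k then row q else Xmat s $$ (r, q))" if "q < n" for q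
        using carrier r that k by (auto simp: upd row_def plane_rot_def)
      then show "(\<Sum>q<n. (?X $$ (r, q))\<^sup>2) = 1"
        using r row_unit unit by (cases "r = k") (simp_all add: unit_rows_def)
    qed (simp add: carrier)
    ultimately show "throughout (safe n) fs s \<and> P (exec fs s)"
      using s unfolding result by (simp add: P_def iteration_inv_def)
  qed
qed (simp add: P_def iteration_inv_def)

lemma triple_jacobi_iteration:
  assumes ij: "i < n" "j < n" "i \<noteq> j"
  shows "triple (safe n) (iteration_inv n) (jacobi_iteration n i j) (iteration_inv n)"
proof -
  have "throughout (safe n) (jacobi_iteration n i j) s \<and>
      iteration_inv n (exec (jacobi_iteration n i j) s)" if inv: "iteration_inv n s" for s
  proof -
    define M where "M = mat_fun (Ahat s)"
    define t where "t = jacobi_tan (M i i) (M j j) (M i j)"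
    define cs where "cs = 1 / sqrt (1 + t\<^sup>2)"
    define sn where "sn = cs * t"
    have contr: "psd_contraction n M"
      using inv by (simp add: iteration_inv_def M_def)
    have unit: "cs\<^sup>2 + sn\<^sup>2 = 1"
      by (rule cos_sin_of_tan(1)[OF cs_def sn_def])
    let ?P = "\<lambda>s. iteration_inv n s \<and> (var_cs s)\<^sup>2 + (var_sn s)\<^sup>2 = 1"
    have "triple (safe n) (\<lambda>s'. s' = s)
        ((jacobi_step1 i j @ jacobi_step2 @ jacobi_step3 i j) @ jacobi_step4 n i j)
        (partly_rotated n i j cs sn M ({..<n} - {i, j}))"
      using triple_steps_1_to_3[OF inv ij M_def t_def cs_def sn_def] triple_step_4[OF contr ij unit]
      by (rule triple_append)
    moreover have "?P s'" if "partly_rotated n i j cs sn M ({..<n} - {i, j}) s'" for s'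
      using that partly_rotated_all[OF contr ij unit that] unit
      by (simp add: iteration_inv_def partly_rotated_def)
    ultimately have "triple (safe n) (\<lambda>s'. s' = s)
        ((jacobi_step1 i j @ jacobi_step2 @ jacobi_step3 i j) @ jacobi_step4 n i j) ?P"
      by (simp add: triple_def)
    from triple_append[OF this triple_step_5[OF ij]] show ?thesis
      by (simp add: triple_def jacobi_iteration_def)
  qed
  then show ?thesis
    by (simp add: triple_def)
qed

lemma triple_jacobi_program:
  "triple (safe n) (iteration_inv n) (jacobi_program n) (iteration_inv n)"
proof -
  have safe: "iteration_inv n s \<Longrightarrow> safe n s" for s
    by (simp add: iteration_inv_def)
  have "triple (safe n) (iteration_inv n) (jacobi_sweep n) (iteration_inv n)"
    unfolding jacobi_sweep_def
    by (rule triple_concat_invariant; clarsimp simp: safe)+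
      (auto intro!: triple_concat_invariant triple_jacobi_iteration simp: safe)
  then show ?thesis
    unfolding jacobi_program_def by (intro triple_concat_invariant) (auto simp: safe)
qed


section \<open>The scaled input and the whole run\<close>

text \<open>The arithmetic-geometric mean inequality $2 |v_r v_k| \le v_r^2 + v_k^2$ bounds the form by
  two sums, weighted by row sums and by column sums. By symmetry they are equal.\<close>

lemma quad_form_le_row_sum_bound:
  assumes sym: "\<And>r k. r < n \<Longrightarrow> k < n \<Longrightarrow> M r k = M k r"
    and rows: "\<And>r. r < n \<Longrightarrow> (\<Sum>k<n. \<bar>M r k\<bar>) \<le> N"
  shows "quad_form n M v \<le> N * (\<Sum>r<n. (v r)\<^sup>2)"
proof -
  let ?S = "\<Sum>r<n. \<Sum>k<n. \<bar>M r k\<bar> * (v r)\<^sup>2"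
  have "v r * (v k * M r k) \<le> (\<bar>M r k\<bar> * (v r)\<^sup>2 + \<bar>M r k\<bar> * (v k)\<^sup>2) / 2" for r k
  proof -
    have "2 * (v r * (v k * M r k)) \<le> \<bar>M r k\<bar> * (2 * \<bar>v r\<bar> * \<bar>v k\<bar>)"
      using abs_ge_self[of "v r * (v k * M r k)"] by (simp add: abs_mult mult_ac)
    also have "\<dots> \<le> \<bar>M r k\<bar> * (\<bar>v r\<bar>\<^sup>2 + \<bar>v k\<bar>\<^sup>2)"
      by (intro mult_left_mono sum_squares_bound) simp
    finally show ?thesis by (simp add: algebra_simps)
  qed
  then have "quad_form n M v \<le> (\<Sum>r<n. \<Sum>k<n. (\<bar>M r k\<bar> * (v r)\<^sup>2 + \<bar>M r k\<bar> * (v k)\<^sup>2) / 2)"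
    unfolding quad_form_def sum_distrib_left by (intro sum_mono)
  also have "\<dots> = (?S + (\<Sum>r<n. \<Sum>k<n. \<bar>M r k\<bar> * (v k)\<^sup>2)) / 2"
    by (simp add: sum.distrib flip: sum_divide_distrib)
  also have "(\<Sum>r<n. \<Sum>k<n. \<bar>M r k\<bar> * (v k)\<^sup>2) = ?S"
    by (subst sum.swap) (simp add: sym)
  also have "(?S + ?S) / 2 = (\<Sum>r<n. (\<Sum>k<n. \<bar>M r k\<bar>) * (v r)\<^sup>2)"
    by (simp add: sum_distrib_right)
  also have "\<dots> \<le> (\<Sum>r<n. N * (v r)\<^sup>2)"
    by (intro sum_mono mult_right_mono rows) auto
  finally show ?thesis
    by (simp add: sum_distrib_left)
qed

lemma psd_contraction_scaled:
  assumes psd: "sym_psd_mat n A" and nonzero: "A \<noteq> 0\<^sub>m n n"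
    and m: "m = sqrt (norm1_mat A * norminf_mat A)"
  shows "psd_contraction n (mat_fun ((1 / m) \<cdot>\<^sub>m A))"
proof -
  let ?M = "mat_fun A"
  have carrier: "A \<in> carrier_mat n n" and transpose: "transpose_mat A = A"
    using psd by (auto simp: sym_psd_mat_def)
  have dim: "dim_row A = n" "dim_col A = n"
    using carrier by auto
  have sym: "?M r k = ?M k r" if "r < n" "k < n" for r k
    using index_transpose_mat(1)[of k A r] that by (simp add: mat_fun_def transpose dim)
  have norm_eq: "norm1_mat A = norminf_mat A"
    unfolding norm1_mat_def norminf_mat_def dim
    using sym by (intro arg_cong[where f = Max] image_cong sum.cong refl) (simp add: mat_fun_def)
  have row_sum: "(\<Sum>k<n. \<bar>?M r k\<bar>) \<le> norminf_mat A" if "r < n" for r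
    unfolding norminf_mat_def dim mat_fun_def using that by (intro Max_ge) auto
  obtain r k where rk: "r < n" "k < n" "?M r k \<noteq> 0"
    using nonzero carrier by (metis eq_matI mat_fun_def dim index_zero_mat)
  have "0 < \<bar>?M r k\<bar>"
    using rk by simp
  also have "\<dots> \<le> (\<Sum>k<n. \<bar>?M r k\<bar>)"
    using rk by (intro member_le_sum) auto
  also have "\<dots> \<le> norminf_mat A"
    by (rule row_sum[OF rk(1)])
  finally have pos: "0 < norminf_mat A" .
  then have m_eq: "m = norminf_mat A"
    by (simp add: m norm_eq)
  have "0 \<le> quad_form n ?M v" for v
  proof -
    have "0 \<le> vec n v \<bullet> (A *\<^sub>v vec n v)"
      using psd by (simp add: sym_psd_mat_def)
    also have "\<dots> = quad_form n ?M v"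
      by (simp add: scalar_prod_def quad_form_def mat_fun_def dim lessThan_atLeast0 mult.commute)
    finally show ?thesis .
  qed
  moreover have "quad_form n ?M v \<le> m * (\<Sum>r<n. (v r)\<^sup>2)" for v
    unfolding m_eq by (rule quad_form_le_row_sum_bound[OF sym row_sum])
  moreover have "quad_form n (mat_fun ((1 / m) \<cdot>\<^sub>m A)) v = quad_form n ?M v / m" for v
    by (simp add: quad_form_def mat_fun_def dim flip: sum_divide_distrib)
  moreover have "mat_fun ((1 / m) \<cdot>\<^sub>m A) r k = mat_fun ((1 / m) \<cdot>\<^sub>m A) k r" if "r < n" "k < n" for r k
    using sym[OF that] that by (simp add: mat_fun_def dim)
  ultimately show ?thesis
    using pos by (simp add: psd_contraction_def m_eq divide_le_eq mult.commute)
qed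

lemma iteration_inv_init:
  assumes "Ah \<in> carrier_mat n n" "psd_contraction n (mat_fun Ah)"
  shows "iteration_inv n (jacobi_init n Ah)"
proof -
  have "(\<Sum>k<n. (1\<^sub>m n $$ (r, k))\<^sup>2) = (1::real)" if "r < n" for r
  proof -
    have "(\<Sum>k<n. (1\<^sub>m n $$ (r, k))\<^sup>2) = (\<Sum>k<n. if k = r then 1 else (0::real))"
      using that by (intro sum.cong) auto
    then show ?thesis using that by simp
  qed
  then have "unit_rows n (1\<^sub>m n)"
    by (simp add: unit_rows_def)
  moreover have "entries_bounded n Ah"
    using assms psd_contraction_entry[OF assms(2)] by (simp add: entries_bounded_def mat_fun_def)
  ultimately show ?thesis
    using assms(2) by (simp add: iteration_inv_def safe_def jacobi_init_def unit_rows_bounded)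
qed

theorem theorem2:
  fixes A Ah :: "real mat" and n :: nat and m :: real
  assumes "A \<in> carrier_mat n n"
    and "A \<noteq> 0\<^sub>m n n"
    and "sym_psd_mat n A"
    and "m = sqrt (norm1_mat A * norminf_mat A)"
    and "Ah = (1 / m) \<cdot>\<^sub>m A"
  shows "(\<forall>p \<le> length (jacobi_program n). let s = jacobi_state_at n Ah p in
             (\<forall>r<n. \<forall>k<n. Ahat s $$ (r, k) \<in> {-1..1}) \<and>
             var_t s \<in> {-1..1} \<and>
             var_cs s \<in> {0..1} \<and>
             var_sn s \<in> {-1..1} \<and>
             (\<forall>r<n. \<forall>k<n. Xmat s $$ (r, k) \<in> {-1..1}) \<and>
             var_a s \<in> {0..1} \<and>
             var_b s \<in> {0..1} \<and>
             var_c s \<in> {-1..1}) \<and>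
         (\<forall>i<n. jacobi_eigenvalue n Ah i \<in> {0..1})"
proof -
  have "psd_contraction n (mat_fun Ah)"
    unfolding assms(5) by (rule psd_contraction_scaled[OF assms(3,2,4)])
  moreover have "Ah \<in> carrier_mat n n"
    using assms(1,5) by simp
  ultimately have run: "throughout (safe n) (jacobi_program n) (jacobi_init n Ah)"
    and final: "iteration_inv n (exec (jacobi_program n) (jacobi_init n Ah))"
    using triple_jacobi_program iteration_inv_init by (auto simp: triple_def)
  have "jacobi_eigenvalue n Ah i \<in> {0..1}" if "i < n" for i
  proof -
    let ?M = "mat_fun (Ahat (exec (jacobi_program n) (jacobi_init n Ah)))"
    have "jacobi_eigenvalue n Ah i = ?M i i"
      by (simp add: jacobi_eigenvalue_def jacobi_state_at_def mat_fun_def)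
    then show ?thesis
      using final psd_contraction_diag[of n ?M i] that by (simp add: iteration_inv_def)
  qed
  moreover have "safe n (jacobi_state_at n Ah p)" if "p \<le> length (jacobi_program n)" for p
    using run that by (simp add: throughout_def jacobi_state_at_def)
  ultimately show ?thesis
    by (auto simp: Let_def safe_def entries_bounded_def)
qed

end
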